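(* For $\mu\in(-1,1)$ let $$\mathcal H_\mu=\big\{P\in\mathcal P_{\mathbb R}\;:\;\langle P,X^2\rangle\le 1,\ \langle P,X\rangle=\mu\big\}$$ be the set of Borel probability measures on $\mathbb R$ with second moment at most $1$ and mean $\mu$. Then the optimal e-class for the hypothesis $\mathcal H_\mu$ on $\mathbb R$ exists and is $$\big\{x\mapsto 1+\alpha(x-\mu)+\beta(x^2-1)\;:\;(\alpha,\beta)\in\mathbb R^2,\ \alpha^2+4\mu\alpha\beta+4\beta^2-4\beta\le 0\big\}.$$
   Context: $\mathcal P_{\mathbb R}$ is the set of Borel probability measures on $\mathbb R$; $\langle P,f(X)\rangle$ is the expectation of $f(X)$ for $X\sim P$. A hypothesis on $\mathbb R$ is a non-empty subset $\mathcal H\subseteq\mathcal P_{\mathbb R}$. An e-variable for $\mathcal H$ is a Borel function $E:\mathbb R\to[0,+\infty)$ with $\langle P,E\rangle\le 1$ for all $P\in\mathcal H$; $\mathcal E_{\mathcal H}$ is the set of all e-variables, and an e-class is a subset of $\mathcal E_{\mathcal H}$. For real functions on $\mathbb R$, $f\succeq f'$ means $f(x)\ge f'(x)$ for all $x$. An e-class $\mathcal E\subseteq\mathcal E_{\mathcal H}$ is majorising if for every $E\in\mathcal E_{\mathcal H}$ there is $E'\in\mathcal E$ with $E'\succeq E$. A majorising e-class contained in every other majorising e-class is called optimal (if it exists, it is unique). *)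

theory Defs
  imports "HOL-Probability.Probability"
begin

definition borel_probs :: "real measure set" where
  "borel_probs = {P. prob_space P \<and> sets P = sets borel}"

definition hypothesis :: "real measure set \<Rightarrow> bool" where
  "hypothesis H \<longleftrightarrow> H \<noteq> {} \<and> H \<subseteq> borel_probs"

text \<open>
  The expectation of a nonnegative function is taken in $[0,\infty]$: the Bochner integral of a
  non-integrable function is 0, so it would let such functions pass as e-variables.
\<close>

definition e_variables :: "real measure set \<Rightarrow> (real \<Rightarrow> real) set" where
  "e_variables H = {E. E \<in> borel_measurable borel \<and> (\<forall>x. 0 \<le> E x) \<and>
     (\<forall>P\<in>H. (\<integral>\<^sup>+ x. ennreal (E x) \<partial>P) \<le> 1)}"

definition e_class :: "real measure set \<Rightarrow> (real \<Rightarrow> real) set \<Rightarrow> bool" where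
  "e_class H \<E> \<longleftrightarrow> \<E> \<subseteq> e_variables H"

definition majorising :: "real measure set \<Rightarrow> (real \<Rightarrow> real) set \<Rightarrow> bool" where
  "majorising H \<E> \<longleftrightarrow> e_class H \<E> \<and>
     (\<forall>E \<in> e_variables H. \<exists>E' \<in> \<E>. \<forall>x. E x \<le> E' x)"

definition optimal :: "real measure set \<Rightarrow> (real \<Rightarrow> real) set \<Rightarrow> bool" where
  "optimal H \<E> \<longleftrightarrow> majorising H \<E> \<and> (\<forall>\<E>'. majorising H \<E>' \<longrightarrow> \<E> \<subseteq> \<E>')"

lemma optimal_unique: "optimal H \<E> \<Longrightarrow> optimal H \<E>' \<Longrightarrow> \<E> = \<E>'"
  unfolding optimal_def by blast

definition mean_hyp :: "real \<Rightarrow> real measure set" where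
  "mean_hyp \<mu> = {P \<in> borel_probs.
     integrable P (\<lambda>x. x\<^sup>2) \<and> (LINT x|P. x\<^sup>2) \<le> 1 \<and>
     integrable P (\<lambda>x. x) \<and> (LINT x|P. x) = \<mu>}"

lemma hypothesis_mean_hyp:
  assumes "-1 < \<mu>" "\<mu> < 1"
  shows "hypothesis (mean_hyp \<mu>)"
proof -
  have "\<mu>\<^sup>2 \<le> 1"
    using assms by (simp add: abs_square_le_1)
  then have "return borel \<mu> \<in> mean_hyp \<mu>"
    by (auto simp: mean_hyp_def borel_probs_def integral_return prob_space_return
        integrable_iff_bounded nn_integral_return)
  then show ?thesis
    by (auto simp: hypothesis_def mean_hyp_def)
qed

end

theory Submission
  imports Defs
begin

text \<open>
  Put \<open>f = E - 1\<close>. The parameters \<open>(\<alpha>, \<beta>)\<close> with \<open>f(x) \<le> \<alpha>(x - \<mu>) + \<beta>(x\<^sup>2 - 1)\<close> for all \<open>x\<close> are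
  found by eliminating \<open>\<alpha>\<close> and then \<open>\<beta>\<close> from this system of inequalities. Eliminating \<open>\<alpha>\<close> leaves
  one inequality \<open>F(m) \<le> \<beta> S(m)\<close> for every measure \<open>m\<close> with mean \<open>\<mu>\<close> on at most two points, where
  \<open>F\<close> and \<open>S\<close> are the expectations of \<open>f\<close> and of \<open>x\<^sup>2 - 1\<close>. Eliminating \<open>\<beta>\<close> compares such measures
  with \<open>S < 0\<close> and \<open>S > 0\<close>, and the comparison is the e-variable property for the mixture of the
  two that has second moment exactly 1. The inequality between \<open>\<alpha>\<close>, \<open>\<beta>\<close> is the discriminant
  condition for nonnegativity. No quadratic of the class dominates another one (compare at \<open>\<mu>\<close> and
  at infinity), so every majorising class contains all of them.
\<close>

section \<open>Quadratic polynomials nonnegative on the line\<close>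

lemma quadratic_nonneg_imp_discrim_le:
  fixes a b c :: real
  assumes nonneg: "\<And>x. 0 \<le> a * x\<^sup>2 + b * x + c"
  shows "b\<^sup>2 - 4 * a * c \<le> 0"
proof (rule ccontr)
  define D where "D = b\<^sup>2 - 4 * a * c"
  assume "\<not> b\<^sup>2 - 4 * a * c \<le> 0"
  then have D: "D > 0" by (simp add: D_def)
  have sq: "4 * a * (a * x\<^sup>2 + b * x + c) = (2 * a * x + b)\<^sup>2 - D" for x
    by (simp add: D_def power2_eq_square algebra_simps)
  consider "a = 0" | "a > 0" | "a < 0" by linarith
  then show False
  proof cases
    case 1
    then have "b \<noteq> 0" using D by (auto simp: D_def)
    then show False using nonneg[of "- (c + 1) / b"] 1 by simp
  next
    case 2
    define x where "x = - b / (2 * a)"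
    have "2 * a * x + b = 0" using 2 by (simp add: x_def)
    with sq[of x] D have "4 * a * (a * x\<^sup>2 + b * x + c) < 0" by simp
    moreover have "0 \<le> 4 * a * (a * x\<^sup>2 + b * x + c)"
      using 2 nonneg[of x] by (intro mult_nonneg_nonneg) auto
    ultimately show False by linarith
  next
    case 3
    \<comment> \<open>Here the vertex is a maximum and gives nothing. With
      \<open>2 * a * x + b = D + 1\<close> the square exceeds \<open>D\<close>, so the quadratic has
      the sign of \<open>a\<close> and is negative.\<close>
    define x where "x = (D + 1 - b) / (2 * a)"
    have "2 * a * x + b = D + 1" using 3 by (simp add: x_def)
    then have "4 * a * (a * x\<^sup>2 + b * x + c) = D\<^sup>2 + D + 1"
      unfolding sq by (simp add: power2_eq_square algebra_simps)
    then have "4 * a * (a * x\<^sup>2 + b * x + c) > 0"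
      using D by (simp add: add_nonneg_pos)
    moreover have "4 * a * (a * x\<^sup>2 + b * x + c) \<le> 0"
      using 3 mult_nonpos_nonneg[OF _ nonneg[of x], of "4 * a"] by simp
    ultimately show False by linarith
  qed
qed

lemma discrim_le_imp_quadratic_nonneg:
  fixes a b c x :: real
  assumes "a > 0" and "b\<^sup>2 - 4 * a * c \<le> 0"
  shows "0 \<le> a * x\<^sup>2 + b * x + c"
proof -
  have "4 * a * (a * x\<^sup>2 + b * x + c) = (2 * a * x + b)\<^sup>2 - (b\<^sup>2 - 4 * a * c)"
    by (simp add: power2_eq_square algebra_simps)
  also have "\<dots> \<ge> 0" using assms(2) by (smt (verit) zero_le_power2)
  finally show ?thesis using assms(1) by (simp add: zero_le_mult_iff)
qed

text \<open>The discriminant bound is applied to the polynomial plus 1: then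
  \<open>4 * a * (c + 1)\<close> is strictly negative for \<open>a < 0\<close>, even if
  \<open>c = 0\<close>.\<close>

lemma quadratic_nonneg_imp_lead_nonneg:
  fixes a b c :: real
  assumes nonneg: "\<And>x. 0 \<le> a * x\<^sup>2 + b * x + c"
  shows "0 \<le> a"
proof (rule ccontr)
  assume a: "\<not> 0 \<le> a"
  have "0 \<le> c" using nonneg[of 0] by simp
  have "b\<^sup>2 - 4 * a * (c + 1) \<le> 0"
    using nonneg by (intro quadratic_nonneg_imp_discrim_le) (smt (verit))
  moreover have "4 * a * (c + 1) < 0"
    using a \<open>0 \<le> c\<close> by (simp add: mult_neg_pos)
  ultimately show False by (smt (verit) zero_le_power2)
qed

text \<open>This eliminates one real unknown from a system of lower and upper bounds. It serves
  first for \<open>\<beta>\<close>, then for \<open>\<alpha>\<close>.\<close>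

lemma exists_between:
  fixes A B :: "real set"
  assumes "A \<noteq> {}" "B \<noteq> {}" and le: "\<And>a b. a \<in> A \<Longrightarrow> b \<in> B \<Longrightarrow> a \<le> b"
  obtains c where "\<And>a. a \<in> A \<Longrightarrow> a \<le> c" "\<And>b. b \<in> B \<Longrightarrow> c \<le> b"
proof (rule that[of "Sup A"])
  have "bdd_above A" using \<open>B \<noteq> {}\<close> le by (meson bdd_aboveI ex_in_conv)
  then show "a \<le> Sup A" if "a \<in> A" for a using that by (rule cSup_upper[rotated])
  show "Sup A \<le> b" if "b \<in> B" for b using that assms by (intro cSup_least) auto
qed

section \<open>Testing an e-variable on finitely supported measures\<close>

text \<open>The e-variable is tested on the law of \<open>g\<close> under the weights
  \<open>w\<close>. Indexing the atoms by \<open>A\<close> lets points coincide.\<close>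

lemma e_variable_mean_hyp_finite:
  fixes w g :: "'i \<Rightarrow> real"
  assumes E: "E \<in> e_variables (mean_hyp \<mu>)"
    and "finite A" and w: "\<And>i. i \<in> A \<Longrightarrow> 0 \<le> w i" and "(\<Sum>i\<in>A. w i) = 1"
    and "(\<Sum>i\<in>A. w i * g i) = \<mu>" and "(\<Sum>i\<in>A. w i * (g i)\<^sup>2) \<le> 1"
  shows "(\<Sum>i\<in>A. w i * E (g i)) \<le> 1"
proof -
  define Q where "Q = point_measure A w"
  define P where "P = distr Q borel g"
  have g: "g \<in> measurable Q borel" by (simp add: Q_def)
  have "prob_space Q"
  proof
    show "emeasure Q (space Q) = 1"
      using assms by (simp add: Q_def space_point_measure emeasure_point_measure_finite)
  qed
  then have "prob_space P" unfolding P_def using g by (rule prob_space.prob_space_distr)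
  have int: "integrable P h" if "h \<in> borel_measurable borel" for h :: "real \<Rightarrow> real"
    unfolding P_def integrable_distr_eq[OF g that] unfolding Q_def
    by (rule integrable_point_measure_finite[OF \<open>finite A\<close>])
  have LINT: "(LINT x|P. h x) = (\<Sum>i\<in>A. w i * h (g i))"
    if "h \<in> borel_measurable borel" for h :: "real \<Rightarrow> real"
    unfolding P_def integral_distr[OF g that] unfolding Q_def
    using lebesgue_integral_point_measure_finite[where A = A and f = w and g = "\<lambda>i. h (g i)"]
      \<open>finite A\<close> w by simp
  have "P \<in> mean_hyp \<mu>"
    using assms \<open>prob_space P\<close>
    by (auto simp: mean_hyp_def borel_probs_def int LINT P_def[THEN arg_cong[where f = sets]])
  moreover have "E \<in> borel_measurable borel" and "\<And>x. 0 \<le> E x"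
    using E by (auto simp: e_variables_def)
  ultimately have "(\<integral>\<^sup>+ x. ennreal (E x) \<partial>P) \<le> 1" "integrable P E"
    using E by (simp_all add: e_variables_def int)
  then have "ennreal (LINT x|P. E x) \<le> 1"
    by (simp add: nn_integral_eq_integral \<open>\<And>x. 0 \<le> E x\<close>)
  then show ?thesis
    by (simp add: LINT[OF \<open>E \<in> borel_measurable borel\<close>])
qed

lemma e_variable_mean_hyp_mixture:
  fixes l l' t x y x' y' :: real
  assumes E: "E \<in> e_variables (mean_hyp \<mu>)"
    and t: "0 \<le> t" "t \<le> 1" and l: "0 \<le> l" "l \<le> 1" and l': "0 \<le> l'" "l' \<le> 1"
    and mean: "l * x + (1 - l) * y = \<mu>" "l' * x' + (1 - l') * y' = \<mu>"
    and moment: "t * (l * (x\<^sup>2 - 1) + (1 - l) * (y\<^sup>2 - 1))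
      + (1 - t) * (l' * (x'\<^sup>2 - 1) + (1 - l') * (y'\<^sup>2 - 1)) \<le> 0"
  shows "t * (l * (E x - 1) + (1 - l) * (E y - 1))
      + (1 - t) * (l' * (E x' - 1) + (1 - l') * (E y' - 1)) \<le> 0"
proof -
  \<comment> \<open>The first Boolean selects one of the two measures being mixed, the second one of
    its two points.\<close>
  define w where "w = (\<lambda>(b, c). if b then t * (if c then l else 1 - l)
    else (1 - t) * (if c then l' else 1 - l'))"
  define g where "g = (\<lambda>(b, c). if b then (if c then x else y) else (if c then x' else y'))"
  have sum: "(\<Sum>i\<in>UNIV. w i * h (g i)) =
    t * (l * h x + (1 - l) * h y) + (1 - t) * (l' * h x' + (1 - l') * h y')"
    for h :: "real \<Rightarrow> real"
    by (simp add: w_def g_def UNIV_Times_UNIV[symmetric] sum.cartesian_product[symmetric]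
        UNIV_bool algebra_simps del: UNIV_Times_UNIV)
  have "(\<Sum>i\<in>UNIV. w i * E (g i)) \<le> 1"
  proof (rule e_variable_mean_hyp_finite[OF E])
    show "0 \<le> w i" for i using t l l' by (auto simp: w_def split: prod.split)
    show "(\<Sum>i\<in>UNIV. w i) = 1" using sum[of "\<lambda>_. 1"] by simp
    show "(\<Sum>i\<in>UNIV. w i * g i) = \<mu>" unfolding sum[of "\<lambda>z. z"] mean by (simp add: algebra_simps)
    show "(\<Sum>i\<in>UNIV. w i * (g i)\<^sup>2) \<le> 1"
      using sum[of "\<lambda>z. z\<^sup>2"] moment by (simp add: algebra_simps)
  qed simp
  then show ?thesis unfolding sum by (simp add: algebra_simps)
qed

section \<open>Domination of an e-variable by a quadratic\<close>

lemma e_variable_mean_hyp_le_quadratic: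
  assumes \<mu>: "\<mu> \<in> {-1<..<1}" and E: "E \<in> e_variables (mean_hyp \<mu>)"
  obtains \<alpha> \<beta> where "\<And>x. E x \<le> 1 + \<alpha> * (x - \<mu>) + \<beta> * (x\<^sup>2 - 1)"
proof -
  \<comment> \<open>A triple stands for the measure with mass \<open>l\<close> at \<open>x\<close>
    and \<open>1 - l\<close> at \<open>y\<close>, and \<open>ev\<close> is its expectation. Since
    \<open>x = y\<close> is allowed, the point mass at \<open>\<mu>\<close> is included.\<close>
  define M where "M = {(l, x, y). 0 \<le> l \<and> l \<le> 1 \<and> l * x + (1 - l) * y = \<mu>}"
  define ev where "ev = (\<lambda>h (l, x :: real, y). l * h x + (1 - l) * h y :: real)"
  define F where "F = ev (\<lambda>x. E x - 1)"
  define S where "S = ev (\<lambda>x. x\<^sup>2 - 1)"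
  have mix: "t * F m + (1 - t) * F m' \<le> 0"
    if "m \<in> M" "m' \<in> M" "0 \<le> t" "t \<le> 1" "t * S m + (1 - t) * S m' \<le> 0" for t m m'
    using that e_variable_mean_hyp_mixture[OF E, of t]
    by (auto simp: M_def F_def S_def ev_def)
  have \<mu>2: "\<mu>\<^sup>2 < 1" using \<mu> by (simp add: abs_square_less_1 abs_less_iff)
  have neg: "(1, \<mu>, \<mu>) \<in> M" "S (1, \<mu>, \<mu>) < 0"
    using \<mu>2 by (auto simp: M_def S_def ev_def)
  have pos: "(1/2, \<mu> + 2, \<mu> - 2) \<in> M" "S (1/2, \<mu> + 2, \<mu> - 2) > 0"
  proof -
    show "(1/2, \<mu> + 2, \<mu> - 2) \<in> M" by (simp add: M_def field_simps)
    have "S (1/2, \<mu> + 2, \<mu> - 2) = \<mu>\<^sup>2 + 3"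
      by (simp add: S_def ev_def power2_eq_square field_simps)
    then show "S (1/2, \<mu> + 2, \<mu> - 2) > 0" by (simp add: add_nonneg_pos)
  qed
  obtain \<beta> where lower: "\<And>m. m \<in> M \<Longrightarrow> S m > 0 \<Longrightarrow> F m / S m \<le> \<beta>"
    and upper: "\<And>m. m \<in> M \<Longrightarrow> S m < 0 \<Longrightarrow> \<beta> \<le> F m / S m"
  proof (rule exists_between[of "{F m / S m | m. m \<in> M \<and> S m > 0}"
        "{F m / S m | m. m \<in> M \<and> S m < 0}"])
    fix a b
    assume "a \<in> {F m / S m | m. m \<in> M \<and> S m > 0}" "b \<in> {F m / S m | m. m \<in> M \<and> S m < 0}"
    then obtain m n where m: "m \<in> M" "S m > 0" "a = F m / S m"
      and n: "n \<in> M" "S n < 0" "b = F n / S n" by blast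
    define d where "d = S m - S n"
    have d: "d > 0" using m n by (simp add: d_def)
    have t: "1 - S m / d = - S n / d" using d by (simp add: field_simps d_def)
    \<comment> \<open>These weights cancel the values of \<open>S\<close>, so the mixture has second
      moment exactly 1.\<close>
    have "S m / d * F n + (1 - S m / d) * F m \<le> 0"
      using m n d by (intro mix) (auto simp: t, simp add: d_def)
    then have "(S m * F n - S n * F m) / d \<le> 0" by (simp add: t diff_divide_distrib)
    then have "S m * F n \<le> S n * F m" using d by (simp add: divide_le_0_iff)
    then show "a \<le> b" unfolding m(3) n(3) using m(2) n(2)
      by (simp add: neg_le_divide_eq pos_le_divide_eq mult.commute)
  qed (use neg pos in blast)+
  have F_le: "F m \<le> \<beta> * S m" if m: "m \<in> M" for m
  proof -
    consider "S m > 0" | "S m < 0" | "S m = 0" by linarith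
    then show ?thesis
    proof cases
      case 1 then show ?thesis using lower[OF m] by (simp add: field_simps)
    next
      case 2 then show ?thesis using upper[OF m] by (simp add: field_simps)
    next
      \<comment> \<open>Such a measure does not constrain \<open>\<beta>\<close>, but it lies in the
        hypothesis itself, whence \<open>F m \<le> 0\<close>.\<close>
      case 3 then show ?thesis using mix[OF m m, of 1] by simp
    qed
  qed
  define h where "h = (\<lambda>x. E x - 1 - \<beta> * (x\<^sup>2 - 1))"
  have pair: "l * h x + (1 - l) * h y \<le> 0" if "(l, x, y) \<in> M" for l x y
    using F_le[OF that] by (simp add: F_def S_def ev_def h_def algebra_simps)
  \<comment> \<open>What remains is a line through \<open>(\<mu>, 0)\<close> above \<open>h\<close>;
    its slope must separate the chord slopes on the two sides of \<open>\<mu>\<close>.\<close>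
  obtain \<alpha> where right: "\<And>x. x > \<mu> \<Longrightarrow> h x / (x - \<mu>) \<le> \<alpha>"
    and left: "\<And>y. y < \<mu> \<Longrightarrow> \<alpha> \<le> h y / (y - \<mu>)"
  proof (rule exists_between[of "{h x / (x - \<mu>) | x. x > \<mu>}" "{h y / (y - \<mu>) | y. y < \<mu>}"])
    show "{h x / (x - \<mu>) | x. x > \<mu>} \<noteq> {}" using gt_ex by blast
    show "{h y / (y - \<mu>) | y. y < \<mu>} \<noteq> {}" using lt_ex by blast
    fix a b
    assume "a \<in> {h x / (x - \<mu>) | x. x > \<mu>}" "b \<in> {h y / (y - \<mu>) | y. y < \<mu>}"
    then obtain x y where x: "x > \<mu>" "a = h x / (x - \<mu>)" and y: "y < \<mu>" "b = h y / (y - \<mu>)"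
      by blast
    define d where "d = x - y"
    have d: "d > 0" using x y by (simp add: d_def)
    have l: "1 - (\<mu> - y) / d = (x - \<mu>) / d" using d by (simp add: field_simps d_def)
    \<comment> \<open>The measure on \<open>x\<close> and \<open>y\<close> with mean
      \<open>\<mu>\<close> weights each point by the distance of the other one from
      \<open>\<mu>\<close>, divided by \<open>d\<close>.\<close>
    have "(\<mu> - y) * x + (x - \<mu>) * y = \<mu> * d" by (simp add: d_def algebra_simps)
    then have "(\<mu> - y) / d * x + (x - \<mu>) / d * y = \<mu>"
      using d by (simp add: add_divide_distrib[symmetric])
    then have "((\<mu> - y) / d, x, y) \<in> M"
      using x y d by (simp add: M_def l) (simp add: d_def)
    from pair[OF this] have "((\<mu> - y) * h x + (x - \<mu>) * h y) / d \<le> 0"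
      by (simp add: l add_divide_distrib)
    then have "(\<mu> - y) * h x + (x - \<mu>) * h y \<le> 0" using d by (simp add: divide_le_0_iff)
    then show "a \<le> b" unfolding x(2) y(2) using x(1) y(1)
      by (simp add: neg_le_divide_eq pos_le_divide_eq algebra_simps)
  qed blast+
  have "h x \<le> \<alpha> * (x - \<mu>)" for x
  proof -
    consider "x > \<mu>" | "x < \<mu>" | "x = \<mu>" by linarith
    then show ?thesis
    proof cases
      case 1 then show ?thesis using right[OF 1] by (simp add: pos_divide_le_eq)
    next
      case 2 then show ?thesis using left[OF 2] by (simp add: neg_le_divide_eq)
    next
      case 3 then show ?thesis using pair[OF neg(1)] by simp
    qed
  qed
  then show thesis by (intro that[of \<alpha> \<beta>]) (simp add: h_def algebra_simps)
qed

section \<open>The quadratics of the class\<close>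

lemma quadratic_expand:
  fixes \<alpha> \<beta> \<mu> x :: real
  shows "1 + \<alpha> * (x - \<mu>) + \<beta> * (x\<^sup>2 - 1) = \<beta> * x\<^sup>2 + \<alpha> * x + (1 - \<alpha> * \<mu> - \<beta>)"
  by (simp add: algebra_simps)

text \<open>This identifies the constraint on \<open>(\<alpha>, \<beta>)\<close> as the discriminant
  of the expanded quadratic.\<close>

lemma discrim_quadratic_expand:
  fixes \<alpha> \<beta> \<mu> :: real
  shows "\<alpha>\<^sup>2 - 4 * \<beta> * (1 - \<alpha> * \<mu> - \<beta>) = \<alpha>\<^sup>2 + 4 * \<mu> * \<alpha> * \<beta> + 4 * \<beta>\<^sup>2 - 4 * \<beta>"
  by (simp add: algebra_simps power2_eq_square)

lemma quadratic_e_variable: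
  assumes \<mu>: "\<mu> \<in> {-1<..<1}"
    and disc: "\<alpha>\<^sup>2 + 4 * \<mu> * \<alpha> * \<beta> + 4 * \<beta>\<^sup>2 - 4 * \<beta> \<le> 0"
  shows "(\<lambda>x. 1 + \<alpha> * (x - \<mu>) + \<beta> * (x\<^sup>2 - 1)) \<in> e_variables (mean_hyp \<mu>)" (is "?q \<in> _")
proof -
  have "\<mu>\<^sup>2 < 1" using \<mu> by (simp add: abs_square_less_1 abs_less_iff)
  \<comment> \<open>The quadratic part of the constraint is a nonnegative form because
    \<open>\<mu>\<^sup>2 < 1\<close>, so the constraint forces
    \<open>4 * \<beta> \<ge> 0\<close>.\<close>
  then have "0 \<le> (\<alpha> + 2 * \<mu> * \<beta>)\<^sup>2 + 4 * \<beta>\<^sup>2 * (1 - \<mu>\<^sup>2)" by simp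
  also have "\<dots> = \<alpha>\<^sup>2 + 4 * \<mu> * \<alpha> * \<beta> + 4 * \<beta>\<^sup>2"
    by (simp add: power2_eq_square algebra_simps)
  finally have \<beta>: "\<beta> \<ge> 0" using disc by linarith
  have nonneg: "0 \<le> ?q x" for x
  proof (cases "\<beta> = 0")
    case True
    \<comment> \<open>The constraint is now \<open>\<alpha>\<^sup>2 \<le> 0\<close>, so the function
      is constantly 1.\<close>
    then show ?thesis using disc by simp
  next
    case False
    with \<beta> disc show ?thesis unfolding quadratic_expand
      by (intro discrim_le_imp_quadratic_nonneg) (auto simp: discrim_quadratic_expand)
  qed
  have "(\<integral>\<^sup>+ x. ennreal (?q x) \<partial>P) \<le> 1" if P: "P \<in> mean_hyp \<mu>" for P
  proof -
    interpret prob_space P using P by (simp add: mean_hyp_def borel_probs_def)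
    have int: "integrable P (\<lambda>x. x)" "integrable P (\<lambda>x. x\<^sup>2)"
      and moments: "(LINT x|P. x) = \<mu>" "(LINT x|P. x\<^sup>2) \<le> 1"
      using P by (auto simp: mean_hyp_def)
    have "(LINT x|P. ?q x) = 1 + \<beta> * ((LINT x|P. x\<^sup>2) - 1)"
      using int moments(1) by (simp add: prob_space)
    also have "\<dots> \<le> 1" using \<beta> moments(2) by (simp add: mult_nonneg_nonpos)
    finally show ?thesis
      using int nonneg by (subst nn_integral_eq_integral) auto
  qed
  then show ?thesis using nonneg by (auto simp: e_variables_def)
qed

lemma quadratic_le_imp_eq:
  fixes \<alpha> \<beta> \<alpha>' \<beta>' \<mu> :: real
  assumes \<mu>: "\<mu> \<in> {-1<..<1}"
    and le: "\<And>x. 1 + \<alpha> * (x - \<mu>) + \<beta> * (x\<^sup>2 - 1) \<le> 1 + \<alpha>' * (x - \<mu>) + \<beta>' * (x\<^sup>2 - 1)"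
  shows "\<alpha> = \<alpha>'" "\<beta> = \<beta>'"
proof -
  have "\<mu>\<^sup>2 < 1" using \<mu> by (simp add: abs_square_less_1 abs_less_iff)
  moreover have "0 \<le> (\<beta>' - \<beta>) * (\<mu>\<^sup>2 - 1)"
    using le[of \<mu>] by (simp add: algebra_simps)
  ultimately have "\<beta>' - \<beta> \<le> 0" by (simp add: zero_le_mult_iff)
  moreover have "0 \<le> \<beta>' - \<beta>"
  proof (rule quadratic_nonneg_imp_lead_nonneg)
    show "0 \<le> (\<beta>' - \<beta>) * x\<^sup>2 + (\<alpha>' - \<alpha>) * x + ((\<alpha> - \<alpha>') * \<mu> + \<beta> - \<beta>')" for x
      using le[of x] by (simp add: algebra_simps)
  qed
  ultimately show "\<beta> = \<beta>'" by simp
  \<comment> \<open>The difference is now a multiple of \<open>x - \<mu>\<close>; one point on each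
    side of \<open>\<mu>\<close> forces the factor to vanish.\<close>
  then show "\<alpha> = \<alpha>'" using le[of "\<mu> + 1"] le[of "\<mu> - 1"] by simp
qed

theorem mainTheorem3:
  fixes \<mu> :: real
  assumes "\<mu> \<in> {-1<..<1}"
  shows "optimal (mean_hyp \<mu>)
    {(\<lambda>x. 1 + \<alpha> * (x - \<mu>) + \<beta> * (x\<^sup>2 - 1)) | \<alpha> \<beta>.
      \<alpha>\<^sup>2 + 4 * \<mu> * \<alpha> * \<beta> + 4 * \<beta>\<^sup>2 - 4 * \<beta> \<le> 0}"
    (is "optimal _ ?Q")
proof -
  have dom: "\<exists>q\<in>?Q. \<forall>x. E x \<le> q x" if E: "E \<in> e_variables (mean_hyp \<mu>)" for E
  proof -
    obtain \<alpha> \<beta> where le: "\<And>x. E x \<le> 1 + \<alpha> * (x - \<mu>) + \<beta> * (x\<^sup>2 - 1)"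
      using e_variable_mean_hyp_le_quadratic[OF assms E] by blast
    \<comment> \<open>The majorant inherits nonnegativity from \<open>E\<close>, which yields the
      discriminant condition.\<close>
    have "0 \<le> \<beta> * x\<^sup>2 + \<alpha> * x + (1 - \<alpha> * \<mu> - \<beta>)" for x
      using E le[of x] order_trans unfolding e_variables_def quadratic_expand by blast
    then have "\<alpha>\<^sup>2 + 4 * \<mu> * \<alpha> * \<beta> + 4 * \<beta>\<^sup>2 - 4 * \<beta> \<le> 0"
      unfolding discrim_quadratic_expand[symmetric] by (rule quadratic_nonneg_imp_discrim_le)
    with le show ?thesis by (intro bexI[of _ "\<lambda>x. 1 + \<alpha> * (x - \<mu>) + \<beta> * (x\<^sup>2 - 1)"]) auto
  qed
  have sub: "?Q \<subseteq> e_variables (mean_hyp \<mu>)"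
    using quadratic_e_variable[OF assms] by blast
  have "?Q \<subseteq> \<E>" if \<E>: "majorising (mean_hyp \<mu>) \<E>" for \<E>
  proof
    fix q assume q: "q \<in> ?Q"
    with sub have "q \<in> e_variables (mean_hyp \<mu>)" by (rule subsetD)
    with \<E> obtain E where E: "E \<in> \<E>" "\<And>x. q x \<le> E x"
      unfolding majorising_def by meson
    with \<E> have "E \<in> e_variables (mean_hyp \<mu>)"
      unfolding majorising_def e_class_def by (meson subsetD)
    \<comment> \<open>Now \<open>q \<le> E \<le> q'\<close> with both ends in the class; the ends
      coincide, which forces \<open>E = q\<close>.\<close>
    from dom[OF this] obtain q' where q': "q' \<in> ?Q" "\<And>x. E x \<le> q' x"
      by (elim bexE) simp
    have le: "q x \<le> q' x" for x using E(2) q'(2) by (rule order_trans)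
    obtain \<alpha> \<beta> where q_eq: "q = (\<lambda>x. 1 + \<alpha> * (x - \<mu>) + \<beta> * (x\<^sup>2 - 1))"
      using q by blast
    obtain \<alpha>' \<beta>' where q'_eq: "q' = (\<lambda>x. 1 + \<alpha>' * (x - \<mu>) + \<beta>' * (x\<^sup>2 - 1))"
      using q'(1) by blast
    have "\<alpha> = \<alpha>'" "\<beta> = \<beta>'"
      using quadratic_le_imp_eq[OF assms le[unfolded q_eq q'_eq]] .
    then have "q = q'" unfolding q_eq q'_eq by simp
    then have "q = E" using E(2) q'(2) by (intro ext antisym) simp_all
    with E(1) show "q \<in> \<E>" by simp
  qed
  moreover have "majorising (mean_hyp \<mu>) ?Q"
    unfolding majorising_def e_class_def by (intro conjI ballI sub dom)
  ultimately show ?thesis unfolding optimal_def by (intro conjI allI impI)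
qed

end
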